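(* Let $\mathbb{K}$ be an associative ring with unity (not necessarily commutative), let $p,q$ be positive integers, let $P=[p]\times[q]$ be the $p\times q$-rectangle, let $f\in\mathbb{K}^{\widehat{P}}$ be a $\mathbb{K}$-labeling of $P$, and set $a=f(0)$. Let $u=(k,q)$ and $u'=(k-1,q)$ for some $k\in\{2,3,\ldots,p\}$, and let $d=(i,1)$ and $d'=(i-1,1)$ for some $i\in\{2,3,\ldots,p\}$. Assume that $a$ is invertible. Let $\ell\geq 1$ be an integer such that $R^{\ell+1}f\neq\bot$, where $R$ is birational rowmotion of $P$. Then $$A_{\ell}^{u\to d}=V_{\ell}^{u'\to d'},$$ where $A_\ell^{u\to d}$ and $V_\ell^{u'\to d'}$ are the path sums of down-slacks and up-slacks, respectively, of the labeling $R^\ell f$ (defined in the context).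
   Context: $\mathbb{K}$ is a fixed associative ring with unity, not necessarily commutative. An element is invertible if it has a two-sided inverse $x^{-1}$. $\mathbb{N}=\{0,1,2,\ldots\}$. Extended poset. For a finite poset $P$, $\widehat{P}$ is the poset on the disjoint union $P\sqcup\{0,1\}$ in which $u\le v$ iff ($u,v\in P$ and $u\le v$ in $P$) or $u=0$ or $v=1$. Write $u\lessdot v$ (equivalently $v\gtrdot u$) if $u<v$ and no $w$ satisfies $u<w<v$ (in $\widehat{P}$). Labelings and partial maps. A $\mathbb{K}$-labeling of $P$ is a map $f:\widehat{P}\to\mathbb{K}$; the set of these is $\mathbb{K}^{\widehat{P}}$. A partial map $F:X\dashrightarrow Y$ is a map $X\to Y\sqcup\{\bot\}$, where $\bot$ means "undefined"; it is extended by $F(\bot)=\bot$, and partial maps are composed accordingly. Toggles. For $v\in P$, the toggle $T_v:\mathbb{K}^{\widehat{P}}\dashrightarrow\mathbb{K}^{\widehat{P}}$ is defined by $(T_vf)(w)=f(w)$ for $w\ne v$ and $$(T_vf)(v)=\Big(\sum_{u\in\widehat{P},\,u\lessdot v}f(u)\Big)\cdot f(v)^{-1}\cdot\Big(\sum_{u\in\widehat{P},\,u\gtrdot v}f(u)^{-1}\Big)^{-1};$$ if any inverse in this formula does not exist, then $T_vf:=\bot$. Birational rowmotion. $R:=T_{v_1}\circ T_{v_2}\circ\cdots\circ T_{v_m}:\mathbb{K}^{\widehat{P}}\dashrightarrow\mathbb{K}^{\widehat{P}}$, where $(v_1,\ldots,v_m)$ is any linear extension of $P$ (a list of all elements of $P$,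 each exactly once, such that $v_i<v_j$ implies $i<j$); so the toggles at larger elements are applied first. This partial map does not depend on the choice of linear extension. $R^k$ is the $k$-fold composition, $R^0=\mathrm{id}$. Rectangle. For positive integers $p,q$, the $p\times q$-rectangle is $[p]\times[q]$ with $[n]=\{1,\ldots,n\}$ and order $(i,j)\le(i',j')$ iff $i\le i'$ and $j\le j'$. Slacks and path sums. For $x\in\widehat{P}$ and $\ell\in\mathbb{N}$ with $R^\ell f\ne\bot$, write $x_\ell:=(R^\ell f)(x)$. For $v\in P$ set $$A_\ell^v:=v_\ell\cdot\Big(\sum_{u\in\widehat{P},\,u\lessdot v}u_\ell\Big)^{-1},\qquad V_\ell^v:=\Big(\sum_{u\in\widehat{P},\,u\gtrdot v}(u_\ell)^{-1}\Big)^{-1}\cdot (v_\ell)^{-1},$$ and for $v\in\{0,1\}$ set $A_\ell^v:=V_\ell^v:=1$. A path from $s$ to $t$ ($s,t\in\widehat{P}$) is a sequence $(v_0,v_1,\ldots,v_k)$ of elements of $\widehat{P}$ with $k\geq 0$, $v_0=s$, $v_k=t$ and $v_0\gtrdot v_1\gtrdot\cdots\gtrdot v_k$. For such a path $\mathbf{p}$ set $A_\ell^{\mathbf{p}}:=A_\ell^{v_0}A_\ell^{v_1}\cdots A_\ell^{v_k}$ and $V_\ell^{\mathbf{p}}:=V_\ell^{v_0}V_\ell^{v_1}\cdots V_\ell^{v_k}$. Finally $A_\ell^{s\to t}:=\sum_{\mathbf{p}}A_\ell^{\mathbf{p}}$ and $V_\ell^{s\to t}:=\sum_{\mathbf{p}}V_\ell^{\mathbf{p}}$,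 the sums being over all paths $\mathbf{p}$ from $s$ to $t$ (empty sums are $0$). Under the hypotheses of the claim all the slacks occurring are well-defined. *)

theory Defs
  imports Main "HOL-Library.Product_Order"
begin

text \<open>
  The ring \<open>\<bbbK>\<close> is a type of sort \<open>{ring, monoid_mult}\<close>: an associative, not necessarily
  commutative ring with unity. Unlike \<^class>\<open>ring_1\<close>, this sort does not exclude \<open>0 = 1\<close>.
\<close>

definition is_inverse :: "'k::monoid_mult \<Rightarrow> 'k \<Rightarrow> bool" where
  "is_inverse x y \<longleftrightarrow> x * y = 1 \<and> y * x = 1"

definition is_invertible :: "'k::monoid_mult \<Rightarrow> bool" where
  "is_invertible x \<longleftrightarrow> (\<exists>y. is_inverse x y)"

text \<open>Meaningful only if \<open>x\<close> is invertible; the inverse is then unique.\<close>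

definition rinv :: "'k::monoid_mult \<Rightarrow> 'k" where
  "rinv x = (THE y. is_inverse x y)"

lemma rinv_eqI: "is_inverse x y \<Longrightarrow> rinv x = y"
  unfolding rinv_def is_inverse_def
  by (rule the_equality) (auto, metis mult.assoc mult_1_left mult_1_right)

text \<open>
  A finite poset is a finite subset \<open>P\<close> of an ordered type with the induced order. The
  extended poset is the subset \<open>hat P\<close> of the type below.
\<close>

datatype 'v ext = Zero | El 'v | One

instantiation ext :: (order) order
begin

definition less_eq_ext :: "'a ext \<Rightarrow> 'a ext \<Rightarrow> bool" where
  "u \<le> v \<longleftrightarrow> u = Zero \<or> v = One \<or> (\<exists>x y. u = El x \<and> v = El y \<and> x \<le> y)"

definition less_ext :: "'a ext \<Rightarrow> 'a ext \<Rightarrow> bool" where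
  "u < v \<longleftrightarrow> u \<le> v \<and> \<not> v \<le> (u :: 'a ext)"

instance
proof
  fix x y z :: "'a ext"
  show "x < y \<longleftrightarrow> x \<le> y \<and> \<not> y \<le> x"
    by (simp add: less_ext_def)
  show "x \<le> x"
    by (cases x) (auto simp: less_eq_ext_def)
  show "x \<le> y \<Longrightarrow> y \<le> z \<Longrightarrow> x \<le> z"
    by (auto simp: less_eq_ext_def)
  show "x \<le> y \<Longrightarrow> y \<le> x \<Longrightarrow> x = y"
    by (auto simp: less_eq_ext_def)
qed

end

definition hat :: "'v set \<Rightarrow> 'v ext set" where
  "hat P = insert Zero (insert One (El ` P))"

definition covered_by :: "'v::order set \<Rightarrow> 'v ext \<Rightarrow> 'v ext \<Rightarrow> bool" where
  "covered_by P u v \<longleftrightarrow>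
     u \<in> hat P \<and> v \<in> hat P \<and> u < v \<and> \<not> (\<exists>w \<in> hat P. u < w \<and> w < v)"

definition lower_sum :: "'v::order set \<Rightarrow> ('v ext \<Rightarrow> 'k::{ring,monoid_mult}) \<Rightarrow> 'v ext \<Rightarrow> 'k" where
  "lower_sum P f v = (\<Sum>u \<in> {u. covered_by P u v}. f u)"

definition upper_inv_sum :: "'v::order set \<Rightarrow> ('v ext \<Rightarrow> 'k::{ring,monoid_mult}) \<Rightarrow> 'v ext \<Rightarrow> 'k" where
  "upper_inv_sum P f v = (\<Sum>u \<in> {u. covered_by P v u}. rinv (f u))"

text \<open>
  A labeling is a function on the whole type \<open>'v ext\<close>, of which only the values on \<open>hat P\<close>
  matter. Partial maps are functions into an option type, with \<^const>\<open>None\<close> for \<open>\<bottom>\<close>.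
\<close>

definition toggle ::
  "'v::order set \<Rightarrow> 'v \<Rightarrow> ('v ext \<Rightarrow> 'k::{ring,monoid_mult}) \<Rightarrow> ('v ext \<Rightarrow> 'k) option" where
  "toggle P v f =
     (if is_invertible (f (El v)) \<and>
         (\<forall>u. covered_by P (El v) u \<longrightarrow> is_invertible (f u)) \<and>
         is_invertible (upper_inv_sum P f (El v))
      then Some (f(El v := lower_sum P f (El v) * rinv (f (El v)) * rinv (upper_inv_sum P f (El v))))
      else None)"

definition linear_extension :: "'v::order set \<Rightarrow> 'v list \<Rightarrow> bool" where
  "linear_extension P vs \<longleftrightarrow> distinct vs \<and> set vs = P \<and>
     (\<forall>i < length vs. \<forall>j < length vs. vs ! i < vs ! j \<longrightarrow> i < j)"

lemma linear_extension_exists: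
  assumes "finite P"
  shows "\<exists>vs. linear_extension P vs"
  using assms
proof (induction P rule: finite_psubset_induct)
  case (psubset P)
  show ?case
  proof (cases "P = {}")
    case True
    then show ?thesis by (auto simp: linear_extension_def)
  next
    case False
    obtain m where m: "m \<in> P" "\<And>x. x \<in> P \<Longrightarrow> \<not> m < x"
      using finite_has_maximal[OF psubset.hyps False] by (metis less_le)
    obtain vs where vs: "linear_extension (P - {m}) vs"
      using psubset.IH[of "P - {m}"] m(1) by blast
    have "linear_extension P (vs @ [m])"
      using vs m unfolding linear_extension_def
      by (auto simp: nth_append less_Suc_eq) (metis DiffD1 nth_mem)
    then show ?thesis ..
  qed
qed

text \<open>
  For \<open>vs = [v\<^sub>1, \<dots>, v\<^sub>m]\<close> the fold applies the toggle at \<open>v\<^sub>m\<close> first and that at \<open>v\<^sub>1\<close> last.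
  The result does not depend on the linear extension chosen.
\<close>

definition rowmotion ::
  "'v::order set \<Rightarrow> ('v ext \<Rightarrow> 'k::{ring,monoid_mult}) \<Rightarrow> ('v ext \<Rightarrow> 'k) option" where
  "rowmotion P f =
     foldr (\<lambda>v g. Option.bind g (toggle P v)) (SOME vs. linear_extension P vs) (Some f)"

definition rowmotion_pow ::
  "'v::order set \<Rightarrow> nat \<Rightarrow> ('v ext \<Rightarrow> 'k::{ring,monoid_mult}) \<Rightarrow> ('v ext \<Rightarrow> 'k) option" where
  "rowmotion_pow P n f = ((\<lambda>g. Option.bind g (rowmotion P)) ^^ n) (Some f)"

definition rectangle :: "nat \<Rightarrow> nat \<Rightarrow> (nat \<times> nat) set" where
  "rectangle p q = {1..p} \<times> {1..q}"

text \<open>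
  Slacks and path sums of a labeling \<open>g\<close>. The objects with index \<open>\<ell>\<close> attached to \<open>f\<close> are
  those of \<open>g = the (rowmotion_pow P \<ell> f)\<close>.
\<close>

definition down_slack ::
  "'v::order set \<Rightarrow> ('v ext \<Rightarrow> 'k::{ring,monoid_mult}) \<Rightarrow> 'v ext \<Rightarrow> 'k" where
  "down_slack P g v =
     (if v = Zero \<or> v = One then 1 else g v * rinv (lower_sum P g v))"

definition up_slack ::
  "'v::order set \<Rightarrow> ('v ext \<Rightarrow> 'k::{ring,monoid_mult}) \<Rightarrow> 'v ext \<Rightarrow> 'k" where
  "up_slack P g v =
     (if v = Zero \<or> v = One then 1 else rinv (upper_inv_sum P g v) * rinv (g v))"

definition paths :: "'v::order set \<Rightarrow> 'v ext \<Rightarrow> 'v ext \<Rightarrow> 'v ext list set" where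
  "paths P s t = {vs. vs \<noteq> [] \<and> set vs \<subseteq> hat P \<and> hd vs = s \<and> last vs = t \<and>
     successively (\<lambda>v w. covered_by P w v) vs}"

lemma finite_paths:
  assumes "finite P"
  shows "finite (paths P s t)"
proof (rule finite_subset)
  show "paths P s t \<subseteq> {vs. set vs \<subseteq> hat P \<and> distinct vs}"
  proof
    fix vs assume vs: "vs \<in> paths P s t"
    have "successively (\<lambda>v w. w < v) vs"
      by (rule successively_mono[of "\<lambda>v w. covered_by P w v"])
         (use vs in \<open>auto simp: paths_def covered_by_def\<close>)
    then have "sorted_wrt (\<lambda>v w. w < v) vs"
      by (subst (asm) successively_iff_sorted_wrt_strong) auto
    then have "distinct vs"
      by (induction vs) auto
    with vs show "vs \<in> {vs. set vs \<subseteq> hat P \<and> distinct vs}"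
      by (auto simp: paths_def)
  qed
  show "finite {vs. set vs \<subseteq> hat P \<and> distinct vs}"
    by (rule finite_subset_distinct) (use assms in \<open>simp add: hat_def\<close>)
qed

definition down_path_sum ::
  "'v::order set \<Rightarrow> ('v ext \<Rightarrow> 'k::{ring,monoid_mult}) \<Rightarrow> 'v ext \<Rightarrow> 'v ext \<Rightarrow> 'k" where
  "down_path_sum P g s t = (\<Sum>vs \<in> paths P s t. prod_list (map (down_slack P g) vs))"

definition up_path_sum ::
  "'v::order set \<Rightarrow> ('v ext \<Rightarrow> 'k::{ring,monoid_mult}) \<Rightarrow> 'v ext \<Rightarrow> 'v ext \<Rightarrow> 'k" where
  "up_path_sum P g s t = (\<Sum>vs \<in> paths P s t. prod_list (map (up_slack P g) vs))"

end

theory Submission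
  imports Defs
begin

text \<open>
  Call \<open>x \<rightarrow> y\<close> a jump if \<open>y\<close> has rank one less than \<open>x\<close> and a smaller first coordinate, and give
  it the weight \<open>x\<^sub>\<ell> y\<^sub>\<ell>\<^sup>-\<^sup>1\<close>. Consider paths from \<open>u\<close> to \<open>d'\<close> in which exactly one step is a jump,
  weighted by down-slacks before the jump and by up-slacks after it. Exchanging the jump with the
  ordinary step before it does not change the total weight: if the first coordinate drops by at
  least two along the two steps from \<open>s\<close> to \<open>t\<close>, both totals are \<open>s\<^sub>\<ell> t\<^sub>\<ell>\<^sup>-\<^sup>1\<close>; if it drops by
  one, \<open>s\<close> and \<open>t\<close> span a unit square, and the totals agree by the identity
  \<open>(x + y)\<^sup>-\<^sup>1 x = y\<^sup>-\<^sup>1 (x\<^sup>-\<^sup>1 + y\<^sup>-\<^sup>1)\<^sup>-\<^sup>1\<close> for its other two labels. If the jump comes last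
  it must be \<open>d \<rightarrow> d'\<close>, of weight \<open>A\<^sup>d\<close>, and if it comes first it must be \<open>u \<rightarrow> u'\<close>, of weight
  \<open>V\<^sup>u\<^sup>'\<close>. The two extreme totals are the two path sums.
\<close>

section \<open>Inverses\<close>

lemma rinv_is_inverse: "is_invertible x \<Longrightarrow> is_inverse x (rinv x)"
  using rinv_eqI unfolding is_invertible_def by metis

lemma rinv_right: "is_invertible x \<Longrightarrow> x * rinv x = 1"
  and rinv_left: "is_invertible x \<Longrightarrow> rinv x * x = 1"
  using rinv_is_inverse unfolding is_inverse_def by blast+

lemma is_inverse_sym: "is_inverse x y \<Longrightarrow> is_inverse y x"
  by (simp add: is_inverse_def)

lemma rinv_rinv: "is_invertible x \<Longrightarrow> rinv (rinv x) = x"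
  by (rule rinv_eqI[OF is_inverse_sym[OF rinv_is_inverse]])

lemma rinv_cancel_left: "is_invertible x \<Longrightarrow> rinv x * (x * y) = y"
  and rinv_cancel_right: "is_invertible x \<Longrightarrow> x * (rinv x * y) = y"
  by (simp_all add: rinv_left rinv_right flip: mult.assoc)

lemma is_invertible_mult:
  assumes "is_invertible x" "is_invertible y"
  shows "is_invertible (x * y)"
proof -
  have "is_inverse (x * y) (rinv y * rinv x)"
    using assms by (simp add: is_inverse_def mult.assoc rinv_cancel_left rinv_cancel_right
        rinv_left rinv_right)
  then show ?thesis
    by (auto simp: is_invertible_def)
qed

text \<open>Rests on the noncommutative factorization
  \<open>x + y = x * (rinv x + rinv y) * y\<close>.\<close>

lemma rinv_add_mult:
  fixes x y :: "'k::{ring,monoid_mult}"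
  assumes x: "is_invertible x" and y: "is_invertible y"
    and xy: "is_invertible (x + y)" and u: "is_invertible (rinv x + rinv y)"
  shows "rinv (x + y) * x = rinv y * rinv (rinv x + rinv y)"
proof -
  have "x * (rinv x + rinv y) * y = x + y"
    using x y by (simp add: distrib_left distrib_right mult.assoc rinv_left rinv_cancel_right)
  then have "(x + y) * (rinv y * rinv (rinv x + rinv y)) =
      x * ((rinv x + rinv y) * (y * (rinv y * rinv (rinv x + rinv y))))"
    by (metis mult.assoc)
  also have "\<dots> = x"
    using y u by (simp add: rinv_cancel_right rinv_right)
  finally show ?thesis
    using rinv_cancel_left[OF xy] by metis
qed

section \<open>Rowmotion\<close>

lemma covered_byD: "covered_by P u v \<Longrightarrow> u < v"
  by (simp add: covered_by_def)

lemma less_ext_El [simp]: "El x < El y \<longleftrightarrow> x < y"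
  by (auto simp: less_ext_def less_eq_ext_def less_le_not_le)

text \<open>Larger elements are toggled first, so the toggle at \<open>v\<close> meets final labels
  at the upper covers of \<open>v\<close> and original ones at \<open>v\<close> and its lower
  covers. Sortedness stands in for \<open>linear_extension\<close> because it passes to tails of
  \<open>vs\<close>, as the induction requires.\<close>

lemma toggles_eqs:
  fixes g :: "'v::order ext \<Rightarrow> 'k::{ring,monoid_mult}"
  assumes "foldr (\<lambda>v g. Option.bind g (toggle P v)) vs (Some g) = Some h"
    and "distinct vs" and "sorted_wrt (\<lambda>x y. \<not> y < x) vs"
  shows "(\<forall>x. x \<notin> El ` set vs \<longrightarrow> h x = g x) \<and>
    (\<forall>v\<in>set vs. is_invertible (g (El v)) \<and>
      (\<forall>u. covered_by P (El v) u \<longrightarrow> is_invertible (h u)) \<and>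
      is_invertible (upper_inv_sum P h (El v)) \<and>
      h (El v) = lower_sum P g (El v) * rinv (g (El v)) * rinv (upper_inv_sum P h (El v)))"
  using assms
proof (induction vs arbitrary: h)
  case Nil
  then show ?case by simp
next
  case (Cons v vs)
  obtain h' where h': "foldr (\<lambda>v g. Option.bind g (toggle P v)) vs (Some g) = Some h'"
    and t: "toggle P v h' = Some h"
    using Cons.prems(1) by (auto simp: bind_eq_Some_conv)
  have vs: "distinct vs" "sorted_wrt (\<lambda>x y. \<not> y < x) vs" "v \<notin> set vs"
    "\<And>w. w \<in> set vs \<Longrightarrow> \<not> w < v"
    using Cons.prems by auto
  note IH = Cons.IH[OF h' vs(1,2)]
  have tog: "is_invertible (h' (El v))" "\<And>u. covered_by P (El v) u \<Longrightarrow> is_invertible (h' u)"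
    "is_invertible (upper_inv_sum P h' (El v))"
    and h: "h = h'(El v := lower_sum P h' (El v) * rinv (h' (El v)) *
      rinv (upper_inv_sum P h' (El v)))"
    using t by (auto simp: toggle_def split: if_splits)
  have h'v: "h' (El v) = g (El v)"
    using IH vs(3) by auto
  have low: "lower_sum P h' (El v) = lower_sum P g (El v)"
    unfolding lower_sum_def
  proof (intro sum.cong refl)
    fix u assume "u \<in> {u. covered_by P u (El v)}"
    then have "u \<notin> El ` set vs"
      using vs(4) by (auto dest!: covered_byD)
    then show "h' u = g u"
      using IH by blast
  qed
  \<comment> \<open>The last toggle changes only the label at \<open>v\<close>, and \<open>v\<close>
    lies above no element of \<open>insert v (set vs)\<close>.\<close>
  have eq: "h u = h' u" if "covered_by P (El w) u" "w \<in> insert v (set vs)" for u w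
    using that vs(4) by (auto simp: h dest!: covered_byD)
  then have up: "upper_inv_sum P h (El w) = upper_inv_sum P h' (El w)"
    if "w \<in> insert v (set vs)" for w
    unfolding upper_inv_sum_def by (intro sum.cong) (use that in auto)
  have "is_invertible (g (El w)) \<and> (\<forall>u. covered_by P (El w) u \<longrightarrow> is_invertible (h u)) \<and>
      is_invertible (upper_inv_sum P h (El w)) \<and>
      h (El w) = lower_sum P g (El w) * rinv (g (El w)) * rinv (upper_inv_sum P h (El w))"
    if w: "w \<in> insert v (set vs)" for w
  proof (cases "w = v")
    case True
    then show ?thesis
      using tog h'v low up[OF w] eq w by (auto simp: h)
  next
    case False
    then show ?thesis
      using IH up[OF w] eq[OF _ w] w by (auto simp: h)
  qed
  moreover have "h x = g x" if "x \<notin> El ` set (v # vs)" for x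
    using IH that by (auto simp: h)
  ultimately show ?case by simp
qed

text \<open>Here the linear extension chosen by \<open>SOME\<close> drops out: the equations have
  the same form for every choice.\<close>

lemma rowmotion_eqs:
  fixes g :: "'v::order ext \<Rightarrow> 'k::{ring,monoid_mult}"
  assumes "finite P" and "rowmotion P g = Some h" and "v \<in> P"
  shows rowmotion_invertible: "is_invertible (g (El v))"
    and rowmotion_upper_invertible: "covered_by P (El v) u \<Longrightarrow> is_invertible (h u)"
    and rowmotion_upper_inv_sum_invertible: "is_invertible (upper_inv_sum P h (El v))"
    and rowmotion_value:
      "h (El v) = lower_sum P g (El v) * rinv (g (El v)) * rinv (upper_inv_sum P h (El v))"
proof -
  define vs where "vs = (SOME vs. linear_extension P vs)"
  have "linear_extension P vs"
    unfolding vs_def using linear_extension_exists[OF assms(1)] by (rule someI_ex)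
  then have "distinct vs" "set vs = P" "sorted_wrt (\<lambda>x y. \<not> y < x) vs"
    by (auto simp: linear_extension_def sorted_wrt_iff_nth_less)
       (metis less_trans not_less_iff_gr_or_eq)
  moreover have "foldr (\<lambda>v g. Option.bind g (toggle P v)) vs (Some g) = Some h"
    using assms(2) by (simp add: rowmotion_def vs_def)
  ultimately have *: "\<forall>v\<in>P. is_invertible (g (El v)) \<and>
      (\<forall>u. covered_by P (El v) u \<longrightarrow> is_invertible (h u)) \<and>
      is_invertible (upper_inv_sum P h (El v)) \<and>
      h (El v) = lower_sum P g (El v) * rinv (g (El v)) * rinv (upper_inv_sum P h (El v))"
    using toggles_eqs[of P vs g h] by simp
  show "is_invertible (g (El v))" "covered_by P (El v) u \<Longrightarrow> is_invertible (h u)"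
    "is_invertible (upper_inv_sum P h (El v))"
    "h (El v) = lower_sum P g (El v) * rinv (g (El v)) * rinv (upper_inv_sum P h (El v))"
    using * assms(3) by blast+
qed

text \<open>Solving \<open>rowmotion_value\<close> for the lower sum gives a product of three
  invertible factors. The element \<open>w\<close> makes \<open>h (El v)\<close> one of them:
  \<open>El v\<close> is an upper cover of \<open>w\<close>, so the toggle at \<open>w\<close>
  inverts its new label.\<close>

lemma rowmotion_lower_sum_invertible:
  fixes g :: "'v::order ext \<Rightarrow> 'k::{ring,monoid_mult}"
  assumes "finite P" and "rowmotion P g = Some h" and "v \<in> P" "w \<in> P"
    and "covered_by P (El w) (El v)"
  shows "is_invertible (lower_sum P g (El v))"
proof -
  note inv = rowmotion_eqs[OF assms(1,2,3)]
  have "h (El v) * upper_inv_sum P h (El v) * g (El v) = lower_sum P g (El v)"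
    using inv(1,3) by (simp add: inv(4) mult.assoc rinv_cancel_left rinv_left)
  then show ?thesis
    using inv(1,3) rowmotion_upper_invertible[OF assms(1,2,4,5)] is_invertible_mult by metis
qed

section \<open>Paths\<close>

lemma paths_Cons_Cons:
  "x # w # vs \<in> paths P s t \<longleftrightarrow> x = s \<and> covered_by P w s \<and> w # vs \<in> paths P w t"
  by (auto simp: paths_def covered_by_def)

lemma paths_singleton: "[x] \<in> paths P s t \<longleftrightarrow> x = s \<and> s = t \<and> s \<in> hat P"
  by (auto simp: paths_def)

lemma Nil_notin_paths: "[] \<notin> paths P s t"
  by (simp add: paths_def)

lemma paths_le: "vs \<in> paths P s t \<Longrightarrow> t \<le> s"
proof (induction vs arbitrary: s rule: induct_list012)
  case 1
  then show ?case by (simp add: Nil_notin_paths)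
next
  case (2 x)
  then show ?case by (simp add: paths_singleton)
next
  case (3 x w vs)
  then show ?case
    by (metis paths_Cons_Cons covered_byD less_imp_le order_trans)
qed

lemma paths_ends: "vs \<in> paths P s t \<Longrightarrow> hd vs = s \<and> last vs = t"
  by (simp add: paths_def)

lemma paths_refl:
  assumes "s \<in> hat P"
  shows "paths P s s = {[s]}"
proof (intro equalityI subsetI)
  fix vs assume vs: "vs \<in> paths P s s"
  \<comment> \<open>By \<open>paths_le\<close>, a path that has left \<open>s\<close> downwards
    cannot end at \<open>s\<close>.\<close>
  have "\<not> (covered_by P w s \<and> ws \<in> paths P w s)" for w ws
    using paths_le[of ws P w s] by (auto dest: covered_byD)
  with vs show "vs \<in> {[s]}"
    by (cases vs rule: remdups_adj.cases)
       (auto simp: Nil_notin_paths paths_singleton paths_Cons_Cons)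
qed (use assms in \<open>auto simp: paths_singleton\<close>)

lemma paths_eq_Cons:
  assumes "s \<noteq> t"
  shows "paths P s t = (\<Union>w\<in>{w. covered_by P w s}. (#) s ` paths P w t)"
proof (intro equalityI subsetI)
  fix vs assume "vs \<in> paths P s t"
  then show "vs \<in> (\<Union>w\<in>{w. covered_by P w s}. (#) s ` paths P w t)"
    using assms
    by (cases vs rule: remdups_adj.cases)
       (auto simp: Nil_notin_paths paths_singleton paths_Cons_Cons)
next
  fix vs assume "vs \<in> (\<Union>w\<in>{w. covered_by P w s}. (#) s ` paths P w t)"
  then obtain w ws where w: "vs = s # ws" "covered_by P w s" "ws \<in> paths P w t"
    by auto
  then obtain ws' where "ws = w # ws'"
    by (cases ws) (auto simp: paths_def)
  with w show "vs \<in> paths P s t"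
    by (simp add: paths_Cons_Cons)
qed

lemma paths_eq_snoc:
  assumes "s \<noteq> t"
  shows "paths P s t = (\<Union>w\<in>{w. covered_by P t w}. (\<lambda>vs. vs @ [t]) ` paths P s w)"
proof (intro equalityI subsetI)
  fix vs assume vs: "vs \<in> paths P s t"
  define ws where "ws = butlast vs"
  have ws: "vs = ws @ [t]"
    using vs append_butlast_last_id[of vs] by (simp add: paths_def ws_def)
  with vs assms have "ws \<noteq> []"
    by (auto simp: paths_singleton)
  with vs have "ws \<in> paths P s (last ws)" "covered_by P t (last ws)"
    unfolding ws by (simp_all add: paths_def successively_append_iff)
  with ws show "vs \<in> (\<Union>w\<in>{w. covered_by P t w}. (\<lambda>vs. vs @ [t]) ` paths P s w)"
    by blast
next
  fix vs assume "vs \<in> (\<Union>w\<in>{w. covered_by P t w}. (\<lambda>vs. vs @ [t]) ` paths P s w)"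
  then obtain w ws where ws: "vs = ws @ [t]" "covered_by P t w" "ws \<in> paths P s w"
    by blast
  have "t \<in> hat P"
    using ws(2) by (simp add: covered_by_def)
  with ws show "vs \<in> paths P s t"
    by (simp add: paths_def successively_append_iff)
qed

lemma finite_covers:
  assumes "finite P"
  shows "finite {w. covered_by P w s}" "finite {w. covered_by P s w}"
  by (rule finite_subset[of _ "hat P"]; use assms in \<open>auto simp: hat_def covered_by_def\<close>)+

text \<open>Peels off the first vertex, in step with the defining recursion of
  \<open>steps_jump\<close>.\<close>

lemma path_sum_Cons:
  fixes c :: "'v::order ext \<Rightarrow> 'k::{ring,monoid_mult}"
  assumes "finite P" "s \<noteq> t"
  shows "(\<Sum>vs\<in>paths P s t. prod_list (map c vs)) =
    (\<Sum>w\<in>{w. covered_by P w s}. c s * (\<Sum>vs\<in>paths P w t. prod_list (map c vs)))"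
proof -
  have "(\<Sum>vs\<in>paths P s t. prod_list (map c vs)) =
      (\<Sum>w\<in>{w. covered_by P w s}. \<Sum>vs\<in>(#) s ` paths P w t. prod_list (map c vs))"
    unfolding paths_eq_Cons[OF assms(2)]
    by (rule sum.UNION_disjoint)
       (use assms(1) in \<open>auto simp: finite_covers finite_paths dest: paths_ends\<close>)
  also have "\<dots> = (\<Sum>w\<in>{w. covered_by P w s}. \<Sum>vs\<in>paths P w t. c s * prod_list (map c vs))"
    by (subst sum.reindex) (auto simp: o_def)
  finally show ?thesis
    by (simp add: sum_distrib_left)
qed

text \<open>Peels off the last vertex, in step with \<open>steps_jump_Suc_right\<close>.\<close>

lemma path_sum_snoc:
  fixes c :: "'v::order ext \<Rightarrow> 'k::{ring,monoid_mult}"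
  assumes "finite P" "s \<noteq> t"
  shows "(\<Sum>vs\<in>paths P s t. prod_list (map c vs)) =
    (\<Sum>w\<in>{w. covered_by P t w}. (\<Sum>vs\<in>paths P s w. prod_list (map c vs)) * c t)"
proof -
  have "(\<Sum>vs\<in>paths P s t. prod_list (map c vs)) =
      (\<Sum>w\<in>{w. covered_by P t w}. \<Sum>vs\<in>(\<lambda>vs. vs @ [t]) ` paths P s w. prod_list (map c vs))"
    unfolding paths_eq_snoc[OF assms(2)]
    by (rule sum.UNION_disjoint)
       (use assms(1) in \<open>auto simp: finite_covers finite_paths dest: paths_ends\<close>)
  also have "\<dots> = (\<Sum>w\<in>{w. covered_by P t w}. \<Sum>vs\<in>paths P s w. prod_list (map c vs) * c t)"
    by (subst sum.reindex) (auto simp: o_def inj_on_def)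
  finally show ?thesis
    by (simp add: sum_distrib_right)
qed

section \<open>Moving the jump\<close>

lemma covered_by_rectangle:
  "covered_by (rectangle p q) (El (a, b)) (El (c, d)) \<longleftrightarrow>
     (a, b) \<in> rectangle p q \<and> (c, d) \<in> rectangle p q \<and>
     (c = a + 1 \<and> d = b \<or> c = a \<and> d = b + 1)" (is "?L \<longleftrightarrow> ?R")
proof
  assume L: ?L
  then have in_rect: "(a, b) \<in> rectangle p q" "(c, d) \<in> rectangle p q"
    and less: "(a, b) < (c, d)"
    and none: "\<not> ((x, y) \<in> rectangle p q \<and> (a, b) < (x, y) \<and> (x, y) < (c, d))" for x y
    by (auto simp: covered_by_def hat_def)
  have less_iff: "(x, y) < (x', y') \<longleftrightarrow> x \<le> x' \<and> y \<le> y' \<and> (x < x' \<or> y < y')"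
    for x y x' y' :: nat
    by (auto simp: less_le_not_le)
  \<comment> \<open>If \<open>a < c\<close>, then \<open>(a + 1, b)\<close> is in the rectangle,
    above \<open>(a, b)\<close> and weakly below \<open>(c, d)\<close>, so it equals
    \<open>(c, d)\<close>; if \<open>b < d\<close>, the same holds for
    \<open>(a, b + 1)\<close>.\<close>
  show ?R
    using none[of "a + 1" b] none[of a "b + 1"] in_rect less
    unfolding less_iff rectangle_def mem_Sigma_iff atLeastAtMost_iff by arith
next
  assume R: ?R
  then have "(a, b) < (c, d)"
    by (auto simp: less_le_not_le)
  then have "El (a, b) < El (c, d)"
    by simp
  moreover have False if "w \<in> hat (rectangle p q)" "El (a, b) < w" "w < El (c, d)" for w
    using that R by (cases w) (auto simp: less_ext_def less_eq_ext_def)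
  moreover have "El (a, b) \<in> hat (rectangle p q)" "El (c, d) \<in> hat (rectangle p q)"
    using R by (simp_all add: hat_def)
  ultimately show ?L
    unfolding covered_by_def by blast
qed

lemma finite_rectangle: "finite (rectangle p q)"
  by (simp add: rectangle_def)

lemma not_covered_by_Zero: "\<not> covered_by P w Zero"
  and not_covered_by_One: "\<not> covered_by P One w"
  by (auto simp: covered_by_def less_ext_def less_eq_ext_def)

text \<open>\<open>El (1, 1)\<close> lies strictly between \<open>Zero\<close> and any other element
  of the rectangle.\<close>

lemma Zero_covered_by_rectangle:
  assumes "covered_by (rectangle p q) Zero (El (a, b))"
  shows "a = 1 \<and> b = 1"
proof (rule ccontr)
  assume "\<not> ?thesis"
  moreover have "(a, b) \<in> rectangle p q"
    using assms by (auto simp: covered_by_def hat_def)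
  ultimately have "El (1, 1) \<in> hat (rectangle p q)" "Zero < El (1::nat, 1::nat)"
    "El (1, 1) < El (a, b)"
    by (auto simp: rectangle_def hat_def less_le_not_le) (auto simp: less_ext_def less_eq_ext_def)
  with assms show False
    unfolding covered_by_def by blast
qed

lemma covered_by_One_rectangle:
  assumes "covered_by (rectangle p q) (El (a, b)) One"
  shows "a = p \<and> b = q"
proof (rule ccontr)
  assume "\<not> ?thesis"
  moreover have "(a, b) \<in> rectangle p q"
    using assms by (auto simp: covered_by_def hat_def)
  ultimately have "El (p, q) \<in> hat (rectangle p q)" "El (p, q) < (One :: (nat \<times> nat) ext)"
    "El (a, b) < El (p, q)"
    by (auto simp: rectangle_def hat_def less_le_not_le) (auto simp: less_ext_def less_eq_ext_def)
  with assms show False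
    unfolding covered_by_def by blast
qed

lemma lower_covers_rectangle:
  assumes "(a, b) \<in> rectangle p q" "(a, b) \<noteq> (1, 1)"
  shows "{w. covered_by (rectangle p q) w (El (a, b))} =
    El ` {(c, d) \<in> rectangle p q. c + 1 = a \<and> d = b \<or> c = a \<and> d + 1 = b}" (is "?L = ?R")
proof (rule set_eqI)
  fix w
  show "w \<in> ?L \<longleftrightarrow> w \<in> ?R"
  proof (cases w)
    case Zero
    moreover have "\<not> covered_by (rectangle p q) Zero (El (a, b))"
      using assms(2) Zero_covered_by_rectangle by blast
    ultimately show ?thesis by auto
  next
    case (El v)
    obtain c d where v: "v = (c, d)" by (cases v)
    have "w \<in> ?R \<longleftrightarrow> (c, d) \<in> rectangle p q \<and> (c + 1 = a \<and> d = b \<or> c = a \<and> d + 1 = b)"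
      unfolding El v by (simp add: image_iff)
    then show ?thesis
      using assms(1) unfolding El v mem_Collect_eq covered_by_rectangle by auto
  next
    case One
    then show ?thesis
      by (auto simp: not_covered_by_One)
  qed
qed

lemma upper_covers_rectangle:
  assumes "(a, b) \<in> rectangle p q" "(a, b) \<noteq> (p, q)"
  shows "{w. covered_by (rectangle p q) (El (a, b)) w} =
    El ` {(c, d) \<in> rectangle p q. c = a + 1 \<and> d = b \<or> c = a \<and> d = b + 1}" (is "?L = ?R")
proof (rule set_eqI)
  fix w
  show "w \<in> ?L \<longleftrightarrow> w \<in> ?R"
  proof (cases w)
    case Zero
    then show ?thesis
      by (auto simp: not_covered_by_Zero)
  next
    case (El v)
    obtain c d where v: "v = (c, d)" by (cases v)
    have "w \<in> ?R \<longleftrightarrow> (c, d) \<in> rectangle p q \<and> (c = a + 1 \<and> d = b \<or> c = a \<and> d = b + 1)"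
      unfolding El v by (simp add: image_iff)
    then show ?thesis
      using assms(1) unfolding El v mem_Collect_eq covered_by_rectangle by auto
  next
    case One
    moreover have "\<not> covered_by (rectangle p q) (El (a, b)) One"
      using assms(2) covered_by_One_rectangle by blast
    ultimately show ?thesis by auto
  qed
qed

section \<open>Slacks and jump weights\<close>

text \<open>These conditions make the slacks cancel as expected. The vertex \<open>(1, 1)\<close> is
  exempt from the second one: it covers no element of the rectangle, so
  \<open>rowmotion_lower_sum_invertible\<close> cannot be applied to it.\<close>

locale rectangle_labeling =
  fixes p q :: nat and g :: "(nat \<times> nat) ext \<Rightarrow> 'k::{ring,monoid_mult}"
  assumes label_invertible: "v \<in> rectangle p q \<Longrightarrow> is_invertible (g (El v))"
    and lower_invertible:
      "v \<in> rectangle p q \<Longrightarrow> v \<noteq> (1, 1) \<Longrightarrow> is_invertible (lower_sum (rectangle p q) g (El v))"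
    and upper_invertible:
      "v \<in> rectangle p q \<Longrightarrow> is_invertible (upper_inv_sum (rectangle p q) g (El v))"
begin

abbreviation P where "P \<equiv> rectangle p q"
abbreviation A where "A \<equiv> down_slack P g"
abbreviation V where "V \<equiv> up_slack P g"

text \<open>Extended by zero to pairs that form no jump, so that sums over covers need no side
  condition. The rank of \<open>(a, b)\<close> is taken as \<open>a + b\<close>; an ordinary step
  that lowers the first coordinate is also a jump.\<close>

definition jump :: "(nat \<times> nat) ext \<Rightarrow> (nat \<times> nat) ext \<Rightarrow> 'k" where
  "jump x y = (case (x, y) of
     (El (a, b), El (c, d)) \<Rightarrow> if a + b = c + d + 1 \<and> c < a then g x * rinv (g y) else 0
   | _ \<Rightarrow> 0)"

lemma jump_El:
  "jump (El (a, b)) (El (c, d)) =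
    (if a + b = c + d + 1 \<and> c < a then g (El (a, b)) * rinv (g (El (c, d))) else 0)"
  by (simp add: jump_def)

lemma jump_Zero [simp]: "jump Zero y = 0" and jump_One [simp]: "jump x One = 0"
  by (auto simp: jump_def split: ext.splits)

lemma A_lower_sum:
  assumes "v \<in> P" "v \<noteq> (1, 1)"
  shows "A (El v) * lower_sum P g (El v) = g (El v)"
  using lower_invertible[OF assms] by (simp add: down_slack_def mult.assoc rinv_left)

lemma upper_inv_sum_V:
  assumes "v \<in> P"
  shows "upper_inv_sum P g (El v) * V (El v) = rinv (g (El v))"
  using upper_invertible[OF assms] by (simp add: up_slack_def rinv_cancel_right)

text \<open>The lower covers of \<open>(a, b)\<close> and the upper covers of \<open>(c, d)\<close>
  are the same two vertices, with labels \<open>x\<close> and \<open>y\<close>. Then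
  \<open>rinv_add_mult\<close> is multiplied by the label of \<open>(a, b)\<close> on the left and
  the inverse label of \<open>(c, d)\<close> on the right.\<close>

lemma jump_commute_square:
  assumes s: "(a, b) \<in> P" and t: "(c, d) \<in> P" and "a = c + 1" "b = d + 1"
  shows "A (El (a, b)) * jump (El (a, d)) (El (c, d)) =
    jump (El (a, b)) (El (c, b)) * V (El (c, d))"
proof -
  have in_P: "(a, d) \<in> P" "(c, b) \<in> P"
    using assms by (auto simp: rectangle_def)
  define x y where "x = g (El (a, d))" and "y = g (El (c, b))"
  have "{w. covered_by P w (El (a, b))} = {El (a, d), El (c, b)}"
    by (subst lower_covers_rectangle) (use assms in_P in \<open>auto simp: rectangle_def\<close>)
  then have lo: "lower_sum P g (El (a, b)) = x + y"
    using assms(3) by (simp add: lower_sum_def x_def y_def)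
  have "{w. covered_by P (El (c, d)) w} = {El (a, d), El (c, b)}"
    by (subst upper_covers_rectangle) (use assms in_P in \<open>auto simp: rectangle_def\<close>)
  then have up: "upper_inv_sum P g (El (c, d)) = rinv x + rinv y"
    using assms(3) by (simp add: upper_inv_sum_def x_def y_def)
  have "is_invertible (x + y)" "is_invertible (rinv x + rinv y)"
    using lower_invertible[OF s] upper_invertible[OF t] t assms(3) unfolding lo up
    by (simp_all add: rectangle_def)
  then have "rinv (x + y) * x = rinv y * rinv (rinv x + rinv y)"
    using in_P by (intro rinv_add_mult) (auto simp: x_def y_def label_invertible)
  then have "g (El (a, b)) * (rinv (x + y) * x) * rinv (g (El (c, d))) =
      g (El (a, b)) * (rinv y * rinv (rinv x + rinv y)) * rinv (g (El (c, d)))"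
    by simp
  moreover have "A (El (a, b)) = g (El (a, b)) * rinv (x + y)"
    "V (El (c, d)) = rinv (rinv x + rinv y) * rinv (g (El (c, d)))"
    by (simp_all add: down_slack_def up_slack_def lo up)
  moreover have "jump (El (a, d)) (El (c, d)) = x * rinv (g (El (c, d)))"
    "jump (El (a, b)) (El (c, b)) = g (El (a, b)) * rinv y"
    using assms(3,4) by (simp_all add: jump_El x_def y_def)
  ultimately show ?thesis
    by (simp only: mult.assoc)
qed

lemma jump_commute_El:
  assumes s: "(a, b) \<in> P" and t: "(c, d) \<in> P"
  shows "(\<Sum>w\<in>{w. covered_by P w (El (a, b))}. A (El (a, b)) * jump w (El (c, d))) =
    (\<Sum>w\<in>{w. covered_by P (El (c, d)) w}. jump (El (a, b)) w * V (El (c, d)))"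
    (is "?lhs = ?rhs")
\<comment> \<open>Outside this case every summand on either side is zero.\<close>
proof (cases "a + b = c + d + 2 \<and> c < a")
  case False
  have "jump w (El (c, d)) = 0" if w: "covered_by P w (El (a, b))" for w
  proof (cases w)
    case (El v)
    obtain a' b' where v: "v = (a', b')" by (cases v)
    have "\<not> (a' + b' = c + d + 1 \<and> c < a')"
      using w False unfolding El v covered_by_rectangle by auto
    then show ?thesis
      unfolding El v jump_El by (rule if_not_P)
  qed (use w not_covered_by_One in auto)
  moreover have "jump (El (a, b)) w = 0" if w: "covered_by P (El (c, d)) w" for w
  proof (cases w)
    case (El v)
    obtain c' d' where v: "v = (c', d')" by (cases v)
    have "\<not> (a + b = c' + d' + 1 \<and> c' < a)"
      using w False unfolding El v covered_by_rectangle by auto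
    then show ?thesis
      unfolding El v jump_El by (rule if_not_P)
  qed (use w not_covered_by_Zero in auto)
  ultimately show ?thesis
    by simp
next
  case True
  then have ne: "(a, b) \<noteq> (1, 1)" "(c, d) \<noteq> (p, q)"
    using s t by (auto simp: rectangle_def)
  note covers = lower_covers_rectangle[OF s ne(1)] upper_covers_rectangle[OF t ne(2)]
  show ?thesis
  proof (cases "a = c + 1")
    case 1: True
    with True have 2: "b = d + 1" by simp
    have "{w. covered_by P w (El (a, b))} = {El (a, d), El (c, b)}"
      "{w. covered_by P (El (c, d)) w} = {El (a, d), El (c, b)}"
      unfolding covers using s t 1 2 by (auto simp: rectangle_def)
    \<comment> \<open>On each side one of the two summands vanishes, since a move between
      \<open>(a, b)\<close> and \<open>(a, d)\<close>, or \<open>(c, b)\<close> and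
      \<open>(c, d)\<close>, keeps the first coordinate.\<close>
    then show ?thesis
      using jump_commute_square[OF s t 1 2] 1 2 by (simp add: jump_El)
  next
    case False
    \<comment> \<open>A cover changes the first coordinate by at most one, so now every intermediate
      vertex admits the jump and the full sums \<open>lower_sum\<close> and
      \<open>upper_inv_sum\<close> appear.\<close>
    with True have ne1: "c + 1 < a" by simp
    have "?lhs = (\<Sum>w\<in>{w. covered_by P w (El (a, b))}. A (El (a, b)) * (g w * rinv (g (El (c, d)))))"
      by (rule sum.cong) (use True ne1 in \<open>auto simp: covers jump_El\<close>)
    also have "\<dots> = A (El (a, b)) * lower_sum P g (El (a, b)) * rinv (g (El (c, d)))"
      by (simp add: lower_sum_def sum_distrib_left sum_distrib_right mult.assoc)
    also have "\<dots> = g (El (a, b)) * (upper_inv_sum P g (El (c, d)) * V (El (c, d)))"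
      using A_lower_sum[OF s ne(1)] upper_inv_sum_V[OF t] by simp
    also have "\<dots> = (\<Sum>w\<in>{w. covered_by P (El (c, d)) w}.
        g (El (a, b)) * rinv (g w) * V (El (c, d)))"
      by (simp add: upper_inv_sum_def sum_distrib_left sum_distrib_right mult.assoc)
    also have "\<dots> = ?rhs"
      by (rule sum.cong) (use True ne1 in \<open>auto simp: covers jump_El\<close>)
    finally show ?thesis .
  qed
qed

text \<open>For \<open>s = Zero\<close> or \<open>t = One\<close> both sides vanish. The excluded
  cases \<open>s = One\<close> and \<open>t = Zero\<close> may leave a nonzero term on one side
  only.\<close>

lemma jump_commute:
  assumes "s \<in> hat P" "s \<noteq> One" "t \<in> hat P" "t \<noteq> Zero"
  shows "(\<Sum>w\<in>{w. covered_by P w s}. A s * jump w t) =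
    (\<Sum>w\<in>{w. covered_by P t w}. jump s w * V t)"
  using assms jump_commute_El
  by (cases s; cases t) (auto simp: hat_def not_covered_by_Zero not_covered_by_One)

text \<open>Weighted count of the paths that take \<open>m\<close> ordinary steps and then a jump.\<close>

fun steps_jump :: "nat \<Rightarrow> (nat \<times> nat) ext \<Rightarrow> (nat \<times> nat) ext \<Rightarrow> 'k" where
  "steps_jump 0 s t = jump s t"
| "steps_jump (Suc m) s t = (\<Sum>w\<in>{w. covered_by P w s}. A s * steps_jump m w t)"

text \<open>Moves the jump past the ordinary step before it, which becomes a
  \<open>V\<close>-weighted step at the lower end. The induction adds \<open>A\<close>-weighted
  steps in front of \<open>jump_commute\<close>.\<close>

lemma steps_jump_Suc_right:
  assumes "s \<in> hat P" "s \<noteq> One" "t \<in> hat P" "t \<noteq> Zero"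
  shows "steps_jump (Suc m) s t = (\<Sum>w\<in>{w. covered_by P t w}. steps_jump m s w * V t)"
  using assms
proof (induction m arbitrary: s)
  case 0
  then show ?case
    using jump_commute by simp
next
  case (Suc m)
  have "steps_jump (Suc (Suc m)) s t = (\<Sum>w\<in>{w. covered_by P w s}. A s * steps_jump (Suc m) w t)"
    by simp
  also have "\<dots> = (\<Sum>w\<in>{w. covered_by P w s}. A s *
      (\<Sum>x\<in>{x. covered_by P t x}. steps_jump m w x * V t))"
    by (intro sum.cong refl arg_cong2[where f = "(*)"] Suc.IH)
       (use Suc.prems in \<open>auto simp: covered_by_def less_ext_def less_eq_ext_def\<close>)
  also have "\<dots> = (\<Sum>x\<in>{x. covered_by P t x}. \<Sum>w\<in>{w. covered_by P w s}.
      A s * steps_jump m w x * V t)"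
    unfolding sum_distrib_left mult.assoc by (rule sum.swap)
  also have "\<dots> = (\<Sum>x\<in>{x. covered_by P t x}. steps_jump (Suc m) s x * V t)"
    by (simp add: sum_distrib_right)
  finally show ?case .
qed

section \<open>The two extreme positions of the jump\<close>

lemma paths_eq_empty:
  assumes "(a, b) \<noteq> (c, d)" "a + b \<le> c + d"
  shows "paths P (El (a, b)) (El (c, d)) = {}"
proof -
  have False if "vs \<in> paths P (El (a, b)) (El (c, d))" for vs
    using paths_le[OF that] assms by (auto simp: less_eq_ext_def)
  then show ?thesis by blast
qed

text \<open>A jump never lowers the second coordinate, so within the rectangle only
  \<open>(i, 1)\<close> jumps to \<open>(i - 1, 1)\<close>. The latter is its sole lower cover, so
  the jump weighs exactly the final down-slack. Here \<open>m\<close> counts the steps down to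
  \<open>(i, 1)\<close>.\<close>

lemma steps_jump_eq_down_path_sum:
  assumes "2 \<le> i" "i \<le> p" "(a, b) \<in> P" "a + b = i + 1 + m"
  shows "steps_jump m (El (a, b)) (El (i - 1, 1)) = down_path_sum P g (El (a, b)) (El (i, 1))"
  using assms(3,4)
proof (induction m arbitrary: a b)
  case 0
  show ?case
  proof (cases "(a, b) = (i, 1)")
    case True
    have "{w. covered_by P w (El (i, 1))} = {El (i - 1, 1)}"
      by (subst lower_covers_rectangle) (use assms(1) 0 True in \<open>auto simp: rectangle_def\<close>)
    then have "A (El (i, 1)) = g (El (i, 1)) * rinv (g (El (i - 1, 1)))"
      by (simp add: down_slack_def lower_sum_def)
    moreover have "El (i, 1) \<in> hat P"
      using 0 True by (auto simp: hat_def)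
    ultimately show ?thesis
      using True assms(1) by (simp add: jump_El down_path_sum_def paths_refl)
  next
    case False
    then have "down_path_sum P g (El (a, b)) (El (i, 1)) = 0"
      using paths_eq_empty 0 by (simp add: down_path_sum_def)
    moreover have "jump (El (a, b)) (El (i - 1, 1)) = 0"
      using False 0 assms(1) by (auto simp: jump_El rectangle_def)
    ultimately show ?thesis
      by simp
  qed
next
  case (Suc m)
  have ne: "El (a, b) \<noteq> El (i, 1)" "(a, b) \<noteq> (1, 1)"
    using Suc.prems(2) assms(1) by auto
  have "steps_jump m w (El (i - 1, 1)) = down_path_sum P g w (El (i, 1))"
    if "covered_by P w (El (a, b))" for w
  proof -
    have "w \<in> {w. covered_by P w (El (a, b))}"
      using that by simp
    then obtain c d where "w = El (c, d)" "(c, d) \<in> P" "c + d + 1 = a + b"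
      unfolding lower_covers_rectangle[OF Suc.prems(1) ne(2)] by auto
    then show ?thesis
      using Suc.IH Suc.prems(2) by simp
  qed
  then show ?case
    using path_sum_Cons[OF finite_rectangle ne(1), where c = A]
    by (simp add: down_path_sum_def)
qed

text \<open>Dually, \<open>(k, q)\<close> jumps only to \<open>(k - 1, q)\<close> within the
  rectangle, and being its sole upper cover makes the jump weigh the first up-slack. The induction
  therefore moves the lower end.\<close>

lemma steps_jump_eq_up_path_sum:
  assumes "2 \<le> k" "k \<le> p" "(c, d) \<in> P" "k - 1 + q = c + d + m"
  shows "steps_jump m (El (k, q)) (El (c, d)) = up_path_sum P g (El (k - 1, q)) (El (c, d))"
  using assms(3,4)
proof (induction m arbitrary: c d)
  case 0
  show ?case
  proof (cases "(c, d) = (k - 1, q)")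
    case True
    have k: "(k, q) \<in> P"
      using 0 True assms(1,2) by (auto simp: rectangle_def)
    have "{w. covered_by P (El (k - 1, q)) w} = {El (k, q)}"
      by (subst upper_covers_rectangle) (use assms 0 True k in \<open>auto simp: rectangle_def\<close>)
    then have "V (El (k - 1, q)) = g (El (k, q)) * rinv (g (El (k - 1, q)))"
      using label_invertible[OF k] by (simp add: up_slack_def upper_inv_sum_def rinv_rinv)
    moreover have "El (k - 1, q) \<in> hat P"
      using 0 True by (auto simp: hat_def)
    ultimately show ?thesis
      using True assms(1) by (simp add: jump_El up_path_sum_def paths_refl)
  next
    case False
    then have "up_path_sum P g (El (k - 1, q)) (El (c, d)) = 0"
      using paths_eq_empty[of "k - 1" q c d] 0 by (auto simp: up_path_sum_def)
    moreover have "jump (El (k, q)) (El (c, d)) = 0"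
      using False 0 assms(1) by (auto simp: jump_El rectangle_def)
    ultimately show ?thesis
      by simp
  qed
next
  case (Suc m)
  have ne: "El (k - 1, q) \<noteq> El (c, d)" "(c, d) \<noteq> (p, q)"
    using Suc.prems(2) assms(1,2) by auto
  have hat: "El (k, q) \<in> hat P" "El (c, d) \<in> hat P"
    using Suc.prems(1) assms(1,2) by (auto simp: hat_def rectangle_def)
  have "steps_jump m (El (k, q)) w = up_path_sum P g (El (k - 1, q)) w"
    if "covered_by P (El (c, d)) w" for w
  proof -
    have "w \<in> {w. covered_by P (El (c, d)) w}"
      using that by simp
    then obtain a b where "w = El (a, b)" "(a, b) \<in> P" "a + b = c + d + 1"
      unfolding upper_covers_rectangle[OF Suc.prems(1) ne(2)] by auto
    then show ?thesis
      using Suc.IH Suc.prems(2) by simp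
  qed
  then show ?case
    \<comment> \<open>The defining equations of \<open>steps_jump\<close> stay disabled below, as
      they would unfold at the upper end instead.\<close>
    using path_sum_snoc[OF finite_rectangle ne(1), where c = V] steps_jump_Suc_right[OF hat(1) _ hat(2)]
    by (simp add: up_path_sum_def del: steps_jump.simps)
qed

lemma down_path_sum_eq_up_path_sum:
  assumes "k \<in> {2..p}" "i \<in> {2..p}" "q \<ge> 1"
  shows "down_path_sum P g (El (k, q)) (El (i, 1)) =
    up_path_sum P g (El (k - 1, q)) (El (i - 1, 1))"
\<comment> \<open>If \<open>(k, q)\<close> has smaller rank than \<open>(i, 1)\<close>, there are no
  paths on either side; otherwise the subtraction defining \<open>m\<close> is not
  truncated.\<close>
proof (cases "k + q < i + 1")
  case True
  then have "paths P (El (k, q)) (El (i, 1)) = {}" "paths P (El (k - 1, q)) (El (i - 1, 1)) = {}"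
    by (intro paths_eq_empty; use assms in auto)+
  then show ?thesis
    by (simp add: down_path_sum_def up_path_sum_def)
next
  case False
  define m where "m = k + q - (i + 1)"
  have "steps_jump m (El (k, q)) (El (i - 1, 1)) = down_path_sum P g (El (k, q)) (El (i, 1))"
    by (rule steps_jump_eq_down_path_sum)
       (use assms False in \<open>auto simp: rectangle_def m_def\<close>)
  moreover have "steps_jump m (El (k, q)) (El (i - 1, 1)) =
      up_path_sum P g (El (k - 1, q)) (El (i - 1, 1))"
    by (rule steps_jump_eq_up_path_sum)
       (use assms False in \<open>auto simp: rectangle_def m_def\<close>)
  ultimately show ?thesis
    by simp
qed

end

section \<open>Transfer to iterates of rowmotion\<close>

text \<open>The application producing \<open>g\<close> yields the upper condition; the one applied
  to \<open>g\<close> yields the conditions on labels and lower sums.\<close>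

lemma rectangle_labeling_rowmotion:
  assumes gh: "rowmotion (rectangle p q) f = Some g" "rowmotion (rectangle p q) g = Some h"
  shows "rectangle_labeling p q g"
proof
  fix v assume v: "v \<in> rectangle p q"
  note inv = finite_rectangle[of p q]
  show "is_invertible (g (El v))"
    by (rule rowmotion_invertible[OF inv gh(2) v])
  show "is_invertible (upper_inv_sum (rectangle p q) g (El v))"
    by (rule rowmotion_upper_inv_sum_invertible[OF inv gh(1) v])
  assume ne: "v \<noteq> (1, 1)"
  obtain a b where ab: "v = (a, b)" by (cases v)
  \<comment> \<open>Some element covered by \<open>v\<close>; it exists because \<open>v\<close> is
    not the minimum.\<close>
  define w where "w = (if a = 1 then (1, b - 1) else (a - 1, b))"
  have "w \<in> rectangle p q"
    using v ne by (auto simp: ab w_def rectangle_def)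
  moreover have "covered_by (rectangle p q) (El w) (El v)"
  proof (cases "a = 1")
    case True
    with \<open>w \<in> rectangle p q\<close> v show ?thesis
      unfolding ab w_def if_P[OF True] covered_by_rectangle by (auto simp: rectangle_def)
  next
    case False
    with \<open>w \<in> rectangle p q\<close> v show ?thesis
      unfolding ab w_def if_not_P[OF False] covered_by_rectangle by (auto simp: rectangle_def)
  qed
  ultimately show "is_invertible (lower_sum (rectangle p q) g (El v))"
    using rowmotion_lower_sum_invertible[OF inv gh(2) v] by blast
qed

theorem lemma9p2:
  fixes p q k i l :: nat
    and f :: "(nat \<times> nat) ext \<Rightarrow> 'k::{ring,monoid_mult}"
  assumes "p \<ge> 1" and "q \<ge> 1"
    and "k \<in> {2..p}" and "i \<in> {2..p}"
    and "is_invertible (f Zero)"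
    and "l \<ge> 1"
    and "rowmotion_pow (rectangle p q) (l + 1) f \<noteq> None"
  shows "down_path_sum (rectangle p q) (the (rowmotion_pow (rectangle p q) l f))
           (El (k, q)) (El (i, 1)) =
         up_path_sum (rectangle p q) (the (rowmotion_pow (rectangle p q) l f))
           (El (k - 1, q)) (El (i - 1, 1))"
proof -
  obtain l' where l: "l = Suc l'"
    using assms(6) by (cases l) auto
  \<comment> \<open>The iterates numbered \<open>l - 1\<close>, \<open>l\<close> and
    \<open>l + 1\<close>; the first exists because \<open>l\<close> is positive.\<close>
  obtain e g h where "rowmotion_pow (rectangle p q) l f = Some g"
    and gh: "rowmotion (rectangle p q) e = Some g" "rowmotion (rectangle p q) g = Some h"
    using assms(7) by (auto simp: l rowmotion_pow_def bind_eq_Some_conv)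
  interpret rectangle_labeling p q g
    by (rule rectangle_labeling_rowmotion[OF gh])
  show ?thesis
    using down_path_sum_eq_up_path_sum[OF assms(3,4,2)]
      \<open>rowmotion_pow (rectangle p q) l f = Some g\<close> by simp
qed

end
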